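(* Let $X$ be a complex reflexive Banach space and let $F: X\to X^*$, $x\mapsto f_x$, be a continuous map from $X$ into its dual with closed range and such that (1) $f_x(y)=\overline{f_y(x)}$ for all $x,y\in X$; (2) for every $x\in X$, if $x\in\mathrm{Ker}(f_x)$ then $x=0$. Then the norm of $X$ is equivalent to the Hilbert norm given by $|x|=f_x(x)^{1/2}$.
   Context: $X^*$ denotes the space of continuous linear functionals on $X$ with the dual norm, and $f_x\in X^*$ denotes the image of $x$ under $F$. The range of $F$ is closed in the norm topology of $X^*$. A Hilbert norm is a norm induced by an inner product for which the space is complete; here the inner product is $(x,y)=f_x(y)$, conjugate-linear in the first variable and linear in the second. Two norms $\|\cdot\|$ and $|\cdot|$ are equivalent if there are constants $c,C>0$ with $c\|x\|\le|x|\le C\|x\|$ for all $x\in X$.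
   Formalization: As stated the claim fails up to sign (X = C, f_x(y) = -conj(x)y gives f_x(x) = -|x|^2); the formal conclusion is that the norm is equivalent to the Hilbert norm given by f_x(x)^{1/2} or to the one given by (-f_x(x))^{1/2}. *)

theory Defs
  imports "HOL-Analysis.Analysis"
begin

class complex_normed_vector = real_normed_vector +
  fixes scaleC :: "complex \<Rightarrow> 'a \<Rightarrow> 'a"  (infixr "*\<^sub>C" 75)
  assumes scaleC_add_right: "a *\<^sub>C (x + y) = a *\<^sub>C x + a *\<^sub>C y"
    and scaleC_add_left: "(a + b) *\<^sub>C x = a *\<^sub>C x + b *\<^sub>C x"
    and scaleC_scaleC: "a *\<^sub>C b *\<^sub>C x = (a * b) *\<^sub>C x"
    and scaleC_one: "1 *\<^sub>C x = x"
    and scaleR_scaleC: "r *\<^sub>R x = complex_of_real r *\<^sub>C x"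
    and norm_scaleC: "norm (a *\<^sub>C x) = cmod a * norm x"

class complex_banach = complex_normed_vector + banach

instantiation complex :: complex_banach
begin

definition scaleC_complex :: "complex \<Rightarrow> complex \<Rightarrow> complex"
  where "scaleC_complex a x = a * x"

instance
  by standard (simp_all add: scaleC_complex_def algebra_simps scaleR_conv_of_real norm_mult)

end

text \<open>
  The space of continuous complex-linear functionals. It is carved out of the bounded
  real-linear maps, whose operator norm is the dual norm.
\<close>

typedef (overloaded) 'a cdual =
  "{f :: 'a::complex_normed_vector \<Rightarrow>\<^sub>L complex. \<forall>a x. blinfun_apply f (a *\<^sub>C x) = a * blinfun_apply f x}"
  by (intro exI[of _ 0]) simp

setup_lifting type_definition_cdual

lift_definition cdual_apply :: "'a::complex_normed_vector cdual \<Rightarrow> 'a \<Rightarrow> complex"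
  is "blinfun_apply" .

instantiation cdual :: (complex_normed_vector) complex_normed_vector
begin

lift_definition zero_cdual :: "'a cdual" is 0 by simp
lift_definition plus_cdual :: "'a cdual \<Rightarrow> 'a cdual \<Rightarrow> 'a cdual" is "(+)"
  by (simp add: blinfun.add_left algebra_simps)
lift_definition minus_cdual :: "'a cdual \<Rightarrow> 'a cdual \<Rightarrow> 'a cdual" is "(-)"
  by (simp add: blinfun.diff_left algebra_simps)
lift_definition uminus_cdual :: "'a cdual \<Rightarrow> 'a cdual" is uminus
  by (simp add: blinfun.minus_left)
lift_definition scaleR_cdual :: "real \<Rightarrow> 'a cdual \<Rightarrow> 'a cdual" is scaleR
  by (simp add: blinfun.scaleR_left)
lift_definition scaleC_cdual :: "complex \<Rightarrow> 'a cdual \<Rightarrow> 'a cdual"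
  is "\<lambda>a f. blinfun_compose (blinfun_mult_right a) f"
  by simp
lift_definition norm_cdual :: "'a cdual \<Rightarrow> real" is norm .

definition sgn_cdual :: "'a cdual \<Rightarrow> 'a cdual"
  where "sgn_cdual f = inverse (norm f) *\<^sub>R f"
definition dist_cdual :: "'a cdual \<Rightarrow> 'a cdual \<Rightarrow> real"
  where "dist_cdual f g = norm (f - g)"
definition uniformity_cdual :: "('a cdual \<times> 'a cdual) filter"
  where "uniformity_cdual = (INF e\<in>{0<..}. principal {(f, g). dist f g < e})"
definition open_cdual :: "'a cdual set \<Rightarrow> bool"
  where "open_cdual U = (\<forall>f\<in>U. \<forall>\<^sub>F (f', g) in uniformity. f' = f \<longrightarrow> g \<in> U)"

instance
proof
  fix a b :: complex and r s :: real and f g h :: "'a cdual"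
  show "f + g + h = f + (g + h)" by transfer simp
  show "f + g = g + f" by transfer simp
  show "0 + f = f" by transfer simp
  show "- f + f = 0" by transfer simp
  show "f - g = f + - g" by transfer simp
  show "r *\<^sub>R (f + g) = r *\<^sub>R f + r *\<^sub>R g" by transfer (simp add: algebra_simps)
  show "(r + s) *\<^sub>R f = r *\<^sub>R f + s *\<^sub>R f" by transfer (simp add: algebra_simps)
  show "r *\<^sub>R s *\<^sub>R f = (r * s) *\<^sub>R f" by transfer simp
  show "1 *\<^sub>R f = f" by transfer simp
  show "sgn f = inverse (norm f) *\<^sub>R f" by (rule sgn_cdual_def)
  show "dist f g = norm (f - g)" by (rule dist_cdual_def)
  show "uniformity = (INF e\<in>{0<..}. principal {(f :: 'a cdual, g). dist f g < e})"
    by (rule uniformity_cdual_def)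
  show "open U = (\<forall>f\<in>U. \<forall>\<^sub>F (f', g) in uniformity. f' = f \<longrightarrow> g \<in> U)" for U :: "'a cdual set"
    by (rule open_cdual_def)
  show "norm f = 0 \<longleftrightarrow> f = 0" by transfer simp
  show "norm (f + g) \<le> norm f + norm g" by transfer (rule norm_triangle_ineq)
  show "norm (r *\<^sub>R f) = \<bar>r\<bar> * norm f" by transfer simp
  show "a *\<^sub>C (f + g) = a *\<^sub>C f + a *\<^sub>C g"
    by transfer (simp add: blinfun_eqI blinfun.add_left algebra_simps)
  show "(a + b) *\<^sub>C f = a *\<^sub>C f + b *\<^sub>C f"
    by transfer (simp add: blinfun_eqI blinfun.add_left algebra_simps)
  show "a *\<^sub>C b *\<^sub>C f = (a * b) *\<^sub>C f" by transfer (simp add: blinfun_eqI algebra_simps)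
  show "1 *\<^sub>C f = f" by transfer (simp add: blinfun_eqI)
  show "r *\<^sub>R f = complex_of_real r *\<^sub>C f"
    by transfer (simp add: blinfun_eqI blinfun.scaleR_left scaleR_conv_of_real)
  show "norm (a *\<^sub>C f) = cmod a * norm f"
  proof transfer
    fix a :: complex and f :: "'a \<Rightarrow>\<^sub>L complex"
    have "(\<lambda>x. norm (a * blinfun_apply f x)) = (\<lambda>x. norm (cmod a *\<^sub>R blinfun_apply f x))"
      by (simp add: norm_mult)
    then have "onorm (\<lambda>x. a * blinfun_apply f x) = onorm (\<lambda>x. cmod a *\<^sub>R blinfun_apply f x)"
      by (simp add: onorm_def norm_mult)
    also have "\<dots> = cmod a * onorm (blinfun_apply f)"
      by (simp add: onorm_scaleR blinfun.bounded_linear_right)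
    moreover have "blinfun_apply (blinfun_compose (blinfun_mult_right a) f) = (\<lambda>x. a * blinfun_apply f x)"
      by auto
    ultimately show "norm (blinfun_compose (blinfun_mult_right a) f) = cmod a * norm f"
      by (simp add: norm_blinfun.rep_eq)
  qed
qed

end

definition ker :: "'a::complex_normed_vector cdual \<Rightarrow> 'a set"
  where "ker f = {x. cdual_apply f x = 0}"

text \<open>Surjectivity of the canonical embedding of the space into its bidual.\<close>

definition reflexive_space :: "'a::complex_normed_vector itself \<Rightarrow> bool"
  where "reflexive_space _ \<longleftrightarrow>
    (\<forall>\<Phi> :: 'a cdual cdual. \<exists>x :: 'a. \<forall>f. cdual_apply \<Phi> f = cdual_apply f x)"

definition inner_product :: "('a::complex_normed_vector \<Rightarrow> 'a \<Rightarrow> complex) \<Rightarrow> bool"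
  where "inner_product B \<longleftrightarrow>
    (\<forall>x y z. B x (y + z) = B x y + B x z) \<and>
    (\<forall>a x y. B x (a *\<^sub>C y) = a * B x y) \<and>
    (\<forall>x y z. B (x + y) z = B x z + B y z) \<and>
    (\<forall>a x y. B (a *\<^sub>C x) y = cnj a * B x y) \<and>
    (\<forall>x y. B x y = cnj (B y x)) \<and>
    (\<forall>x. x \<noteq> 0 \<longrightarrow> B x x \<in> \<real> \<and> 0 < Re (B x x))"

definition induced_norm :: "('a \<Rightarrow> 'a \<Rightarrow> complex) \<Rightarrow> 'a \<Rightarrow> real"
  where "induced_norm B x = sqrt (Re (B x x))"

definition hilbert_inner_product :: "('a::complex_normed_vector \<Rightarrow> 'a \<Rightarrow> complex) \<Rightarrow> bool"
  where "hilbert_inner_product B \<longleftrightarrow>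
    inner_product B \<and> Metric_space.mcomplete UNIV (\<lambda>x y. induced_norm B (x - y))"

definition equivalent_norms :: "('a \<Rightarrow> real) \<Rightarrow> ('a \<Rightarrow> real) \<Rightarrow> bool"
  where "equivalent_norms N M \<longleftrightarrow>
    (\<exists>c C. 0 < c \<and> 0 < C \<and> (\<forall>x. c * N x \<le> M x \<and> M x \<le> C * N x))"

text \<open>
  A Hermitian form without nonzero isotropic vectors may be negative definite, as
  \<open>\<lambda>x y. - (cnj x * y)\<close> on the complex numbers shows. Without a sign condition on a form \<open>B\<close>,
  the predicate below can therefore only be expected of one of \<open>B\<close> and \<open>- B\<close>.
\<close>

definition equivalent_to_hilbert_norm :: "('a::complex_normed_vector \<Rightarrow> 'a \<Rightarrow> complex) \<Rightarrow> bool"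
  where "equivalent_to_hilbert_norm B \<longleftrightarrow>
    hilbert_inner_product B \<and> equivalent_norms norm (induced_norm B)"

end

theory Submission
  imports Defs
begin

text \<open>
  The form \<open>B x y = f\<^sub>x y\<close> is Hermitian, so \<open>F\<close> is conjugate-linear, and a form without nonzero
  isotropic vectors is definite. Being injective, continuous and real-linear with closed range, \<open>F\<close>
  is bounded below by the Banach open mapping argument: \<open>c \<parallel>x\<parallel> \<le> \<parallel>f\<^sub>x\<parallel>\<close>. The Cauchy--Schwarz
  inequality gives \<open>\<bar>f\<^sub>x y\<bar> \<le> \<bar>x\<bar> \<bar>y\<bar> \<le> M \<bar>x\<bar> \<parallel>y\<parallel>\<close>, that is \<open>\<parallel>f\<^sub>x\<parallel> \<le> M \<bar>x\<bar>\<close>, whence \<open>c \<parallel>x\<parallel> \<le> M \<bar>x\<bar>\<close>.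
\<close>

section \<open>Bounded operators with complete range\<close>

text \<open>Continuity at 0 keeps the values below 1 on a ball of radius \<open>d\<close>; rescaling
  an arbitrary nonzero vector to norm \<open>d / 2\<close> gives the constant
  \<open>2 / d\<close>.\<close>

lemma continuous_linear_imp_bounded_linear:
  fixes T :: "'a::real_normed_vector \<Rightarrow> 'b::real_normed_vector"
  assumes "linear T" and "isCont T 0"
  shows "bounded_linear T"
proof -
  interpret linear T by (rule assms(1))
  obtain d where d: "0 < d" "\<And>x. norm x < d \<Longrightarrow> norm (T x) < 1"
    using assms(2)[unfolded continuous_at_eps_delta, rule_format, of 1]
    by (auto simp: dist_norm zero)
  show ?thesis
  proof (rule bounded_linear_intro[where K = "2 / d"])
    fix x
    show "norm (T x) \<le> norm x * (2 / d)"
    proof (cases "x = 0")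
      case False
      define t where "t = d / (2 * norm x)"
      have "0 < t" "norm (t *\<^sub>R x) < d" using d(1) False by (auto simp: t_def)
      then have "t * norm (T x) < 1" using d(2)[of "t *\<^sub>R x"] by (simp add: scale)
      then show ?thesis using d(1) False by (simp add: t_def field_simps)
    qed (simp add: zero)
  qed (simp_all add: add scale)
qed

text \<open>This is the Baire category half of the open mapping theorem. The error is a fixed
  fraction of \<open>norm (T z)\<close>, so that the approximation can be iterated.\<close>

lemma approximate_preimages_complete_range:
  fixes T :: "'a::real_normed_vector \<Rightarrow> 'b::real_normed_vector"
  assumes T: "bounded_linear T" and complete: "complete (range T)"
  obtains K where "0 \<le> K"
    "\<And>z. \<exists>x. norm x \<le> K * norm (T z) \<and> norm (T z - T x) \<le> norm (T z) / 2"
proof -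
  interpret T: bounded_linear T by (rule T)
  \<comment> \<open>Baire's theorem is applied inside \<open>range T\<close>, which need not be the
    whole codomain; closures and interiors below are relative to it.\<close>
  interpret M: Metric_space "range T" dist
    by standard (auto simp: dist_commute dist_triangle)
  have mcomplete: "M.mcomplete"
    unfolding M.mcomplete_def
  proof (intro allI impI)
    fix \<sigma> assume \<sigma>: "M.MCauchy \<sigma>"
    then have "\<forall>n. \<sigma> n \<in> range T" "Cauchy \<sigma>"
      unfolding M.MCauchy_def Cauchy_def by auto
    with complete obtain l where l: "l \<in> range T" "\<sigma> \<longlonglongrightarrow> l"
      unfolding complete_def by blast
    then show "\<exists>x. limitin M.mtopology \<sigma> x sequentially"
      using \<open>\<forall>n. \<sigma> n \<in> range T\<close> unfolding M.limit_metric_sequentially lim_sequentially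
      by (intro exI[of _ l]) simp
  qed
  define A where "A n = M.mtopology closure_of (T ` cball 0 (real n))" for n
  have "range T \<subseteq> \<Union> (range A)"
  proof
    fix y assume "y \<in> range T"
    then obtain x where "y = T x" by blast
    moreover obtain n where "norm x \<le> real n"
      using real_arch_simple by blast
    ultimately have "y \<in> T ` cball 0 (real n)" by simp
    moreover have "T ` cball 0 (real n) \<subseteq> A n"
      unfolding A_def by (rule closure_of_subset) auto
    ultimately show "y \<in> \<Union> (range A)" by blast
  qed
  moreover have "\<Union> (range A) \<subseteq> range T"
    using closure_of_subset_topspace[of M.mtopology] unfolding A_def by fastforce
  ultimately have cover: "\<Union> (range A) = topspace M.mtopology"
    unfolding M.topspace_mtopology by (rule equalityI[rotated])
  then have "M.mtopology interior_of \<Union> (range A) \<noteq> {}"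
    unfolding cover interior_of_topspace by simp
  \<comment> \<open>The range is nonempty and is the union of the countably many closed sets
    \<open>A n\<close>, so these cannot all have empty interior.\<close>
  then obtain n where "M.mtopology interior_of A n \<noteq> {}"
    using M.metric_Baire_category_alt[OF mcomplete, of "range A"] unfolding A_def
    by fastforce
  then obtain y0 e where y0: "y0 \<in> range T" and e: "e > 0" and sub: "M.mball y0 e \<subseteq> A n"
    unfolding M.metric_interior_of by blast
  have approx: "\<exists>x. norm x \<le> real n \<and> dist y (T x) < d"
    if "y \<in> range T" "dist y0 y < e" "d > 0" for y d
  proof -
    have "y \<in> A n" using sub that y0 by auto
    then show ?thesis
      using \<open>d > 0\<close> unfolding A_def M.metric_closure_of by fastforce
  qed
  show thesis
  proof
    show "0 \<le> 4 * real n / e" using e by simp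
    fix z
    show "\<exists>x. norm x \<le> 4 * real n / e * norm (T z) \<and> norm (T z - T x) \<le> norm (T z) / 2"
    proof (cases "T z = 0")
      case True
      then show ?thesis by (intro exI[of _ 0]) (simp add: T.zero)
    next
      case False
      \<comment> \<open>This scaling gives \<open>t *\<^sub>R T z\<close> norm \<open>e / 2\<close>,
        so translating \<open>y0\<close> by it stays inside the ball. Approximating both
        \<open>y0\<close> and the translate and subtracting cancels \<open>y0\<close>; the two
        errors \<open>e / 8\<close> add up to \<open>e / 4\<close>, which is half of
        \<open>t * norm (T z)\<close>.\<close>
      define t where "t = e / (2 * norm (T z))"
      have t: "t > 0" "t * norm (T z) = e / 2"
        using False e by (auto simp: t_def)
      obtain w where w: "y0 = T w" using y0 by blast
      have "y0 + t *\<^sub>R T z = T (w + t *\<^sub>R z)"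
        by (simp add: w T.add T.scaleR)
      moreover have "dist y0 (y0 + t *\<^sub>R T z) < e"
        using t e by (simp add: dist_norm)
      ultimately obtain x1 where x1: "norm x1 \<le> real n" "dist (y0 + t *\<^sub>R T z) (T x1) < e / 8"
        using approx[of "y0 + t *\<^sub>R T z" "e / 8"] e by auto
      obtain x2 where x2: "norm x2 \<le> real n" "dist y0 (T x2) < e / 8"
        using approx[of y0 "e / 8"] e y0 by auto
      have n12: "norm (x1 - x2) \<le> 2 * real n"
        using norm_triangle_ineq4[of x1 x2] x1 x2 by linarith
      have "norm (t *\<^sub>R T z - T (x1 - x2)) = norm ((y0 + t *\<^sub>R T z - T x1) - (y0 - T x2))"
        by (simp add: T.diff algebra_simps)
      also have "\<dots> \<le> norm (y0 + t *\<^sub>R T z - T x1) + norm (y0 - T x2)"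
        by (rule norm_triangle_ineq4)
      also have "\<dots> \<le> e / 8 + e / 8"
        using x1(2) x2(2) unfolding dist_norm by (intro add_mono less_imp_le)
      finally have "norm (t *\<^sub>R T z - T (x1 - x2)) \<le> e / 8 + e / 8" .
      moreover have "t *\<^sub>R T z - T (x1 - x2) = t *\<^sub>R (T z - T ((1 / t) *\<^sub>R (x1 - x2)))"
        using t(1) by (simp add: T.scaleR scaleR_diff_right[of t])
      ultimately have "t * norm (T z - T ((1 / t) *\<^sub>R (x1 - x2))) \<le> t * (norm (T z) / 2)"
        using t by (simp only: norm_scaleR)
      then have "norm (T z - T ((1 / t) *\<^sub>R (x1 - x2))) \<le> norm (T z) / 2"
        using t(1) by (simp only: mult_le_cancel_left_pos)
      \<comment> \<open>Since \<open>1 / t = 2 * norm (T z) / e\<close>, the radius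
        \<open>2 * real n\<close> turns into the constant \<open>4 * real n / e\<close>.\<close>
      moreover have "norm ((1 / t) *\<^sub>R (x1 - x2)) \<le> (1 / t) * (2 * real n)"
        using n12 t(1) by (simp add: divide_right_mono)
      then have "norm ((1 / t) *\<^sub>R (x1 - x2)) \<le> 4 * real n / e * norm (T z)"
        using e False by (simp add: t_def field_simps)
      ultimately show ?thesis by blast
    qed
  qed
qed

text \<open>Successive correction: approximate preimages of the remaining errors form an absolutely
  convergent series, because the domain is complete. Its sum has the same image as \<open>z\<close>,
  so injectivity identifies it with \<open>z\<close>, and the geometric series bounds its
  norm.\<close>

theorem bounded_below_complete_range:
  fixes T :: "'a::banach \<Rightarrow> 'b::real_normed_vector"
  assumes T: "bounded_linear T" and inj: "inj T" and complete: "complete (range T)"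
  obtains C where "0 < C" "\<And>x. norm x \<le> C * norm (T x)"
proof -
  interpret T: bounded_linear T by (rule T)
  obtain K where K: "0 \<le> K"
    and "\<And>z. \<exists>x. norm x \<le> K * norm (T z) \<and> norm (T z - T x) \<le> norm (T z) / 2"
    using approximate_preimages_complete_range[OF T complete] by blast
  then obtain g where g: "\<And>z. norm (g z) \<le> K * norm (T z)"
    and Tg: "\<And>z. norm (T z - T (g z)) \<le> norm (T z) / 2"
    by metis
  have bound: "norm z \<le> 2 * K * norm (T z)" for z
  proof -
    \<comment> \<open>\<open>r n\<close> is what remains of \<open>z\<close> after \<open>n\<close>
      corrections; its image at least halves in norm at each step, while \<open>r n\<close> itself
      is not claimed to tend to 0.\<close>
    define r where "r n = ((\<lambda>z. z - g z) ^^ n) z" for n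
    have r_Suc: "r (Suc n) = r n - g (r n)" for n by (simp add: r_def)
    have Tr: "norm (T (r n)) \<le> (1 / 2) ^ n * norm (T z)" for n
    proof (induction n)
      case 0
      then show ?case by (simp add: r_def)
    next
      case (Suc n)
      then show ?case using Tg[of "r n"] by (simp add: r_Suc T.diff)
    qed
    have le: "norm (g (r n)) \<le> (K * norm (T z)) * (1 / 2) ^ n" for n
    proof -
      have "norm (g (r n)) \<le> K * ((1 / 2) ^ n * norm (T z))"
        using g[of "r n"] mult_left_mono[OF Tr K] by (rule order_trans)
      then show ?thesis by (simp add: algebra_simps)
    qed
    have geometric: "(\<lambda>n. (K * norm (T z)) * (1 / 2) ^ n) sums ((K * norm (T z)) * 2)"
      using sums_mult[OF geometric_sums[of "1 / 2 :: real"]] by simp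
    have summable: "summable (\<lambda>n. g (r n))"
      by (rule summable_comparison_test'[OF sums_summable[OF geometric] le])
    have norm: "norm (\<Sum>n. g (r n)) \<le> (K * norm (T z)) * 2"
      by (rule norm_sums_le[OF summable_sums[OF summable] geometric le])
    \<comment> \<open>The corrections telescope, so the partial sums have images
      \<open>T z - T (r n)\<close>, which converge to \<open>T z\<close>.\<close>
    have partial: "(\<Sum>k<n. g (r k)) = z - r n" for n
      by (induction n) (simp_all add: r_Suc, simp add: r_def)
    have "(\<lambda>n. T z - T (r n)) \<longlonglongrightarrow> T (\<Sum>n. g (r n))"
      using T.tendsto[OF summable_LIMSEQ[OF summable]] by (simp add: partial T.diff)
    moreover have "(\<lambda>n. T (r n)) \<longlonglongrightarrow> 0"
    proof (rule Lim_null_comparison)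
      show "\<forall>\<^sub>F n in sequentially. norm (T (r n)) \<le> (1 / 2) ^ n * norm (T z)"
        using Tr by simp
      show "(\<lambda>n. (1 / 2) ^ n * norm (T z)) \<longlonglongrightarrow> 0"
        by (intro tendsto_mult_left_zero LIMSEQ_realpow_zero) auto
    qed
    then have "(\<lambda>n. T z - T (r n)) \<longlonglongrightarrow> T z - 0"
      by (intro tendsto_intros)
    ultimately have "T (\<Sum>n. g (r n)) = T z"
      using LIMSEQ_unique by fastforce
    then have "(\<Sum>n. g (r n)) = z" using inj by (simp add: inj_eq)
    with norm show ?thesis by (simp add: mult_ac)
  qed
  show thesis
  proof
    \<comment> \<open>\<open>K\<close> may be 0; adding 1 makes the constant strictly
      positive.\<close>
    show "0 < 2 * K + 1" using K by simp
    show "norm x \<le> (2 * K + 1) * norm (T x)" for x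
      using bound[of x] by (simp add: distrib_right add_increasing2)
  qed
qed

section \<open>The dual space\<close>

lemma norm_cdual_apply_le: "norm (cdual_apply f x) \<le> norm f * norm x"
  by transfer (rule norm_blinfun)

lemma norm_cdual_le:
  assumes "0 \<le> b" and "\<And>x. norm (cdual_apply f x) \<le> b * norm x"
  shows "norm f \<le> b"
  using assms by transfer (rule norm_blinfun_bound)

lemma cdual_eqI: "(\<And>x. cdual_apply f x = cdual_apply g x) \<Longrightarrow> f = g"
  by transfer (rule blinfun_eqI)

lemma cdual_apply_add_right: "cdual_apply f (x + y) = cdual_apply f x + cdual_apply f y"
  by transfer (rule blinfun.add_right)

lemma cdual_apply_scaleC_right: "cdual_apply f (a *\<^sub>C x) = a * cdual_apply f x"
  by transfer simp

lemma cdual_apply_add_left: "cdual_apply (f + g) x = cdual_apply f x + cdual_apply g x"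
  by transfer (rule blinfun.add_left)

lemma cdual_apply_scaleC_left: "cdual_apply (a *\<^sub>C f) x = a * cdual_apply f x"
  by transfer simp

text \<open>The representation is an isometry into the complete space of bounded real-linear maps,
  and complex homogeneity survives limits because evaluation at a vector is continuous. Completeness
  is what later makes a closed range complete.\<close>

instance cdual :: (complex_normed_vector) complex_banach
proof
  fix f :: "nat \<Rightarrow> 'a cdual"
  assume "Cauchy f"
  have dist: "dist (Rep_cdual g) (Rep_cdual h) = dist g h" for g h :: "'a cdual"
    by (simp add: dist_norm norm_cdual.rep_eq minus_cdual.rep_eq)
  have "Cauchy (\<lambda>n. Rep_cdual (f n))"
    using \<open>Cauchy f\<close> by (simp add: Cauchy_def dist)
  then obtain l where l: "(\<lambda>n. Rep_cdual (f n)) \<longlonglongrightarrow> l"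
    using Cauchy_convergent convergent_def by blast
  have "blinfun_apply l (a *\<^sub>C x) = a * blinfun_apply l x" for a x
  proof (rule LIMSEQ_unique)
    show "(\<lambda>n. Rep_cdual (f n) (a *\<^sub>C x)) \<longlonglongrightarrow> l (a *\<^sub>C x)"
      by (intro tendsto_intros l)
    have "(\<lambda>n. a * Rep_cdual (f n) x) \<longlonglongrightarrow> a * l x"
      by (intro tendsto_intros l)
    then show "(\<lambda>n. Rep_cdual (f n) (a *\<^sub>C x)) \<longlonglongrightarrow> a * l x"
      using Rep_cdual[of "f _"] by simp
  qed
  then have "l = Rep_cdual (Abs_cdual l)"
    by (simp add: Abs_cdual_inverse)
  with l have "f \<longlonglongrightarrow> Abs_cdual l"
    unfolding lim_sequentially by (metis dist)
  then show "convergent f" by (rule convergentI)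
qed

section \<open>Definiteness and inner products\<close>

lemma scaleC_real: "complex_of_real r *\<^sub>C x = r *\<^sub>R x"
  by (simp add: scaleR_scaleC)

text \<open>If the form were positive at \<open>x\<close> and negative at \<open>y\<close>, the
  quadratic polynomial \<open>b (x + t *\<^sub>R y) (x + t *\<^sub>R y)\<close> in \<open>t\<close>
  would have a real root. Anisotropy then makes \<open>x\<close> a multiple of \<open>y\<close>,
  where the form cannot be positive.\<close>

lemma anisotropic_symmetric_form_definite:
  fixes b :: "'a::real_vector \<Rightarrow> 'a \<Rightarrow> real"
  assumes bil: "bilinear b" and sym: "\<And>x y. b x y = b y x"
    and anisotropic: "\<And>x. b x x = 0 \<Longrightarrow> x = 0"
  shows "(\<forall>x. x \<noteq> 0 \<longrightarrow> 0 < b x x) \<or> (\<forall>x. x \<noteq> 0 \<longrightarrow> b x x < 0)"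
proof (rule ccontr)
  assume "\<not> ?thesis"
  then obtain x y where x: "0 < b x x" and y: "b y y < 0"
    by (metis anisotropic linorder_cases)
  \<comment> \<open>\<open>d\<close> is a quarter of the discriminant of that polynomial and
    \<open>t\<close> is one of its roots; completing the square confirms this.\<close>
  define d where "d = (b x y)\<^sup>2 - b x x * b y y"
  define t where "t = (sqrt d - b x y) / b y y"
  have "d \<ge> 0" using mult_pos_neg[OF x y] zero_le_power2[of "b x y"] unfolding d_def by linarith
  have "b y y * t + b x y = sqrt d" using y by (simp add: t_def)
  then have "(b y y * t + b x y)\<^sup>2 = d" using \<open>d \<ge> 0\<close> by simp
  then have "b y y * (b x x + 2 * t * b x y + t\<^sup>2 * b y y) = 0"
    by (simp add: d_def power2_eq_square algebra_simps)
  then have "b x x + 2 * t * b x y + t\<^sup>2 * b y y = 0" using y by simp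
  moreover have "b (x + t *\<^sub>R y) (x + t *\<^sub>R y) = b x x + 2 * t * b x y + t\<^sup>2 * b y y"
    using sym[of y x]
    by (simp add: bilinear_ladd[OF bil] bilinear_radd[OF bil] bilinear_lmul[OF bil]
        bilinear_rmul[OF bil] power2_eq_square algebra_simps)
  ultimately have "x + t *\<^sub>R y = 0" using anisotropic by simp
  then have "x = (- t) *\<^sub>R y" by (simp add: eq_neg_iff_add_eq_0)
  then have "b x x = t * t * b y y"
    by (simp add: bilinear_lneg[OF bil] bilinear_rneg[OF bil] bilinear_lmul[OF bil]
        bilinear_rmul[OF bil])
  moreover have "t * t * b y y \<le> 0"
    using y by (simp add: mult_nonneg_nonpos)
  ultimately show False using x by linarith
qed

section \<open>The norm induced by an inner product\<close>

context
  fixes B :: "'a::complex_normed_vector \<Rightarrow> 'a \<Rightarrow> complex"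
  assumes B: "inner_product B"
begin

lemma inner_product_add_right: "B x (y + z) = B x y + B x z"
  and inner_product_scaleC_right: "B x (a *\<^sub>C y) = a * B x y"
  and inner_product_add_left: "B (x + y) z = B x z + B y z"
  and inner_product_scaleC_left: "B (a *\<^sub>C x) y = cnj a * B x y"
  and inner_product_commute: "B x y = cnj (B y x)"
  and inner_product_pos: "x \<noteq> 0 \<Longrightarrow> 0 < Re (B x x)"
  using B unfolding inner_product_def by blast+

lemma inner_product_zero: "B 0 x = 0"
  using inner_product_add_left[of 0 0 x] by simp

lemma inner_product_self_nonneg: "0 \<le> Re (B x x)"
  using inner_product_pos[of x] inner_product_zero by (cases "x = 0") auto

lemma inner_product_self: "B x x = of_real (Re (B x x))"
  using arg_cong[OF inner_product_commute[of x x], of Im] by (simp add: complex_eq_iff)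

lemma inner_product_cauchy_schwarz: "norm (B x y) \<le> induced_norm B x * induced_norm B y"
proof (cases "y = 0")
  case True
  then show ?thesis
    using inner_product_zero inner_product_commute[of x y]
    by (simp add: induced_norm_def)
next
  case False
  define Q where "Q = Re (B y y)"
  define a where "a = B y x"
  have Q: "0 < Q" using inner_product_pos[OF False] by (simp add: Q_def)
  \<comment> \<open>This is \<open>Q\<close> times the component of \<open>x\<close> orthogonal to
    \<open>y\<close>; multiplying by \<open>Q = Re (B y y)\<close> avoids quotients. Nonnegativity
    of the form at this vector is the Cauchy-Schwarz inequality.\<close>
  let ?z = "of_real Q *\<^sub>C x + (- a) *\<^sub>C y"
  have "B y y = of_real Q" "B x y = cnj a" "B x x = of_real (Re (B x x))"
    using inner_product_self inner_product_commute[of x y] by (simp_all add: Q_def a_def)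
  then have "B ?z ?z = of_real Q * (of_real Q * of_real (Re (B x x)) - a * cnj a)"
    by (simp add: inner_product_add_right inner_product_add_left inner_product_scaleC_right
        inner_product_scaleC_left a_def algebra_simps)
  also have "\<dots> = of_real (Q * (Q * Re (B x x) - (cmod a)\<^sup>2))"
    by (simp add: complex_norm_square[symmetric])
  finally have "0 \<le> Q * (Q * Re (B x x) - (cmod a)\<^sup>2)"
    using inner_product_self_nonneg[of ?z] by simp
  then have "(cmod a)\<^sup>2 \<le> Re (B x x) * Q"
    using Q by (simp add: zero_le_mult_iff algebra_simps)
  then have "cmod a \<le> sqrt (Re (B x x) * Q)"
    by (rule real_le_rsqrt)
  moreover have "cmod (B x y) = cmod a"
    using inner_product_commute[of x y] by (simp add: a_def)
  ultimately show ?thesis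
    by (simp add: induced_norm_def Q_def real_sqrt_mult)
qed

lemma induced_norm_triangle: "induced_norm B (x + y) \<le> induced_norm B x + induced_norm B y"
proof -
  have sq: "(induced_norm B z)\<^sup>2 = Re (B z z)" for z
    by (simp add: induced_norm_def inner_product_self_nonneg)
  have "Re (B (x + y) (x + y)) = Re (B x x) + 2 * Re (B x y) + Re (B y y)"
    using inner_product_commute[of y x]
    by (simp add: inner_product_add_right inner_product_add_left)
  also have "\<dots> \<le> Re (B x x) + 2 * (induced_norm B x * induced_norm B y) + Re (B y y)"
    using complex_Re_le_cmod[of "B x y"] inner_product_cauchy_schwarz[of x y] by linarith
  also have "\<dots> = (induced_norm B x + induced_norm B y)\<^sup>2"
    by (simp add: power2_sum sq)
  finally have "(induced_norm B (x + y))\<^sup>2 \<le> (induced_norm B x + induced_norm B y)\<^sup>2"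
    by (simp add: sq)
  then show ?thesis
    by (rule power2_le_imp_le) (simp add: induced_norm_def inner_product_self_nonneg)
qed

lemma induced_norm_diff_commute: "induced_norm B (x - y) = induced_norm B (y - x)"
proof -
  have "x - y = (- 1) *\<^sub>C (y - x)"
    using scaleC_real[of "- 1" "y - x"] by simp
  then show ?thesis
    by (simp only: induced_norm_def inner_product_scaleC_left inner_product_scaleC_right) simp
qed

lemma induced_norm_eq_0_iff: "induced_norm B x = 0 \<longleftrightarrow> x = 0"
  using inner_product_pos[of x] inner_product_zero
  by (cases "x = 0") (auto simp: induced_norm_def)

lemma Metric_space_induced_norm: "Metric_space UNIV (\<lambda>x y. induced_norm B (x - y))"
proof
  show "0 \<le> induced_norm B (x - y)" for x y
    by (simp add: induced_norm_def inner_product_self_nonneg)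
  show "induced_norm B (x - y) = 0 \<longleftrightarrow> x = y" for x y
    by (simp add: induced_norm_eq_0_iff)
  show "induced_norm B (x - z) \<le> induced_norm B (x - y) + induced_norm B (y - z)" for x y z
    using induced_norm_triangle[of "x - y" "y - z"] by simp
qed (rule induced_norm_diff_commute)

end

text \<open>The lower estimate turns a Cauchy sequence for the induced norm into one for the given
  norm, and the upper estimate carries its limit back.\<close>

lemma mcomplete_induced_norm:
  fixes B :: "'a::complex_banach \<Rightarrow> 'a \<Rightarrow> complex"
  assumes B: "inner_product B" and equiv: "equivalent_norms norm (induced_norm B)"
  shows "Metric_space.mcomplete UNIV (\<lambda>x y. induced_norm B (x - y))"
proof -
  interpret Metric_space UNIV "\<lambda>x y. induced_norm B (x - y)"
    by (rule Metric_space_induced_norm[OF B])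
  obtain c C where c: "0 < c" "\<And>x. c * norm x \<le> induced_norm B x"
    and C: "0 < C" "\<And>x. induced_norm B x \<le> C * norm x"
    using equiv unfolding equivalent_norms_def by blast
  show ?thesis
    unfolding mcomplete_def
  proof (intro allI impI)
    fix \<sigma> assume \<sigma>: "MCauchy \<sigma>"
    have "Cauchy \<sigma>"
    proof (rule CauchyI)
      fix e :: real assume "0 < e"
      then obtain N where N: "\<And>m n. N \<le> m \<Longrightarrow> N \<le> n \<Longrightarrow> induced_norm B (\<sigma> m - \<sigma> n) < c * e"
        using \<sigma> c(1) unfolding MCauchy_def by (metis mult_pos_pos)
      have "norm (\<sigma> m - \<sigma> n) < e" if "N \<le> m" "N \<le> n" for m n
      proof -
        have "c * norm (\<sigma> m - \<sigma> n) < c * e"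
          using c(2) N[OF that] by (rule le_less_trans)
        then show ?thesis using c(1) by simp
      qed
      then show "\<exists>N. \<forall>m\<ge>N. \<forall>n\<ge>N. norm (\<sigma> m - \<sigma> n) < e" by blast
    qed
    then obtain l where l: "\<sigma> \<longlonglongrightarrow> l"
      using Cauchy_convergent convergent_def by blast
    have "limitin mtopology \<sigma> l sequentially"
      unfolding limit_metric_sequentially
    proof (intro conjI allI impI)
      fix e :: real assume "0 < e"
      then obtain N where N: "\<And>n. N \<le> n \<Longrightarrow> norm (\<sigma> n - l) < e / C"
        using LIMSEQ_D[OF l, of "e / C"] C(1) by auto
      have "induced_norm B (\<sigma> n - l) < e" if "N \<le> n" for n
      proof -
        have "C * norm (\<sigma> n - l) < e"
          using N[OF that] C(1) by (simp add: pos_less_divide_eq mult.commute)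
        with C(2) show ?thesis by (rule le_less_trans)
      qed
      then show "\<exists>N. \<forall>n\<ge>N. \<sigma> n \<in> UNIV \<and> induced_norm B (\<sigma> n - l) < e" by blast
    qed simp
    then show "\<exists>x. limitin mtopology \<sigma> x sequentially" ..
  qed
qed

text \<open>The last assumption says that \<open>\<parallel>x\<parallel> \<le> C \<parallel>B x\<parallel>\<close> for the dual norm of \<open>B x\<close>.\<close>

lemma equivalent_to_hilbert_normI:
  fixes B :: "'a::complex_banach \<Rightarrow> 'a \<Rightarrow> complex"
  assumes B: "inner_product B"
    and M: "0 < M" "\<And>x y. norm (B x y) \<le> M * norm x * norm y"
    and C: "0 < C" "\<And>x K. 0 \<le> K \<Longrightarrow> (\<And>y. norm (B x y) \<le> K * norm y) \<Longrightarrow> norm x \<le> C * K"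
  shows "equivalent_to_hilbert_norm B"
proof -
  have upper: "induced_norm B x \<le> sqrt M * norm x" for x
  proof -
    have "Re (B x x) \<le> M * norm x * norm x"
      using complex_Re_le_cmod M(2) by (rule order_trans)
    then have "sqrt (Re (B x x)) \<le> sqrt (M * norm x * norm x)"
      by (rule real_sqrt_le_mono)
    then show ?thesis by (simp add: induced_norm_def real_sqrt_mult mult.assoc)
  qed
  have nonneg: "0 \<le> induced_norm B x" for x
    by (simp add: induced_norm_def inner_product_self_nonneg[OF B])
  have lower: "norm x \<le> C * sqrt M * induced_norm B x" for x
  proof -
    \<comment> \<open>Cauchy-Schwarz and the upper estimate at \<open>y\<close> make
      \<open>sqrt M * induced_norm B x\<close> an admissible bound \<open>K\<close> for the
      functional \<open>B x\<close>.\<close>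
    have "norm (B x y) \<le> sqrt M * induced_norm B x * norm y" for y
    proof -
      have "norm (B x y) \<le> induced_norm B x * induced_norm B y"
        by (rule inner_product_cauchy_schwarz[OF B])
      also have "\<dots> \<le> induced_norm B x * (sqrt M * norm y)"
        by (intro mult_left_mono upper nonneg)
      finally show ?thesis by (simp add: algebra_simps)
    qed
    then have "norm x \<le> C * (sqrt M * induced_norm B x)"
      using M(1) nonneg by (intro C(2)) auto
    then show ?thesis by (simp add: mult.assoc)
  qed
  have "equivalent_norms norm (induced_norm B)"
    unfolding equivalent_norms_def
  proof (intro exI conjI allI)
    show "0 < 1 / (C * sqrt M)" "0 < sqrt M" using M(1) C(1) by simp_all
    show "1 / (C * sqrt M) * norm x \<le> induced_norm B x" for x
      using lower[of x] M(1) C(1) by (simp add: field_simps)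
  qed (rule upper)
  then show ?thesis
    using B mcomplete_induced_norm[OF B]
    unfolding equivalent_to_hilbert_norm_def hilbert_inner_product_def by blast
qed

section \<open>The Hermitian form given by \<open>F\<close>\<close>

theorem theorem5:
  fixes F :: "'a::complex_banach \<Rightarrow> 'a cdual"
  assumes "reflexive_space TYPE('a)"
    and "continuous_on UNIV F"
    and "closed (range F)"
    and "\<And>x y. cdual_apply (F x) y = cnj (cdual_apply (F y) x)"
    and "\<And>x. x \<in> ker (F x) \<Longrightarrow> x = 0"
  shows "equivalent_to_hilbert_norm (\<lambda>x y. cdual_apply (F x) y) \<or>
    equivalent_to_hilbert_norm (\<lambda>x y. - cdual_apply (F x) y)"
proof -
  define B where "B x y = cdual_apply (F x) y" for x y
  have commute: "B x y = cnj (B y x)" for x y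
    unfolding B_def by (rule assms(4))
  have add_right: "B x (y + z) = B x y + B x z" for x y z
    by (simp add: B_def cdual_apply_add_right)
  have scale_right: "B x (a *\<^sub>C y) = a * B x y" for a x y
    by (simp add: B_def cdual_apply_scaleC_right)
  \<comment> \<open>\<open>F\<close> is not assumed linear: its conjugate-linearity comes from
    linearity in the second variable through Hermitian symmetry.\<close>
  have add_left: "B (x + y) z = B x z + B y z" for x y z
    using commute[of "x + y" z] commute[of x z] commute[of y z] by (simp add: add_right)
  have scale_left: "B (a *\<^sub>C x) y = cnj a * B x y" for a x y
    using commute[of "a *\<^sub>C x" y] commute[of x y] by (simp add: scale_right)
  have self: "B x x \<in> \<real>" for x
    using commute[of x x] by (metis Reals_cnj_iff)
  \<comment> \<open>The diagonal of the form is real, so its real part alone decides whether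
    \<open>x\<close> lies in \<open>ker (F x)\<close>.\<close>
  have anisotropic: "x = 0" if "Re (B x x) = 0" for x
  proof -
    have "B x x = 0" using that self[of x] by (simp add: complex_eq_iff complex_is_Real_iff)
    then show ?thesis using assms(5)[of x] by (simp add: B_def ker_def)
  qed

  \<comment> \<open>Conjugation fixes real scalars, so the conjugate-linear \<open>F\<close> is
    real-linear, which is enough for the operator bounds.\<close>
  have "linear F"
  proof
    show "F (x + y) = F x + F y" for x y
      using add_left unfolding B_def by (intro cdual_eqI) (simp add: cdual_apply_add_left)
    show "F (r *\<^sub>R x) = r *\<^sub>R F x" for r x
      using scale_left[of "of_real r" x] unfolding B_def scaleR_scaleC
      by (intro cdual_eqI) (simp add: cdual_apply_scaleC_left)
  qed
  moreover have "isCont F 0"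
    using assms(2) by (simp add: continuous_on_eq_continuous_at)
  ultimately have F: "bounded_linear F"
    by (rule continuous_linear_imp_bounded_linear)
  interpret F: bounded_linear F by (rule F)
  have "x = 0" if "F x = 0" for x
    using anisotropic[of x] that F.zero add_left[of 0 0 x] by (simp add: B_def)
  then have "inj F"
    by (simp add: linear_injective_0[OF \<open>linear F\<close>])
  then obtain C where C: "0 < C" "\<And>x. norm x \<le> C * norm (F x)"
    using bounded_below_complete_range[OF F] assms(3) by (auto simp: complete_eq_closed)
  obtain M where M: "0 < M" "\<And>x. norm (F x) \<le> norm x * M"
    using F.pos_bounded by blast
  have upper: "norm (B x y) \<le> M * norm x * norm y" for x y
  proof -
    have "norm (B x y) \<le> norm (F x) * norm y"
      unfolding B_def by (rule norm_cdual_apply_le)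
    also have "\<dots> \<le> norm x * M * norm y"
      by (intro mult_right_mono M) simp
    finally show ?thesis by (simp add: mult.commute)
  qed
  \<comment> \<open>Any \<open>K\<close> bounding the functional dominates its dual norm. Phrasing
    the estimate through values of \<open>B\<close> lets it serve for \<open>- B\<close> as
    well.\<close>
  have lower: "norm x \<le> C * K" if "0 \<le> K" "\<And>y. norm (B x y) \<le> K * norm y" for x K
  proof -
    have "norm (F x) \<le> K"
      using that unfolding B_def by (rule norm_cdual_le)
    then have "C * norm (F x) \<le> C * K" using C(1) by simp
    with C(2) show ?thesis by (rule order_trans)
  qed

  \<comment> \<open>Passing to real parts gives a symmetric real bilinear form with the same
    diagonal, to which the definiteness criterion applies.\<close>
  have "bilinear (\<lambda>x y. Re (B x y))"
    using scale_left[of "of_real _"] scale_right[of _ "of_real _"]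
    by (auto simp: bilinear_def scaleR_scaleC add_left add_right intro!: linearI)
  moreover have "Re (B x y) = Re (B y x)" for x y
    using commute[of x y] by simp
  ultimately consider "\<forall>x. x \<noteq> 0 \<longrightarrow> 0 < Re (B x x)" | "\<forall>x. x \<noteq> 0 \<longrightarrow> Re (B x x) < 0"
    using anisotropic_symmetric_form_definite[of "\<lambda>x y. Re (B x y)"] anisotropic by blast
  then show ?thesis
  proof cases
    case 1
    then have "inner_product B"
      unfolding inner_product_def
      by (intro conjI allI add_right scale_right add_left scale_left commute) (simp add: self)
    then have "equivalent_to_hilbert_norm B"
      using M(1) upper C(1) lower by (rule equivalent_to_hilbert_normI)
    then show ?thesis unfolding B_def ..
  next
    case 2
    \<comment> \<open>In the negative definite case the sign change restores positivity and leaves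
      all absolute values, hence both estimates, unchanged.\<close>
    have "inner_product (\<lambda>x y. - B x y)"
      unfolding inner_product_def
    proof (intro conjI allI)
      show "- B x y = cnj (- B y x)" for x y
        by (subst commute) simp
    qed (use 2 in \<open>simp_all add: add_right scale_right add_left scale_left self\<close>)
    then have "equivalent_to_hilbert_norm (\<lambda>x y. - B x y)"
      using M(1) _ C(1) by (rule equivalent_to_hilbert_normI) (simp_all add: upper lower)
    then show ?thesis unfolding B_def ..
  qed
qed

end
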